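(* Let $A$ be a $2\times 2$ real matrix and consider the linear time-invariant system $\dot r(t)=Ar(t)$, $r(t)\in\mathbb{R}^2$. For a solution $r(t)=\mathrm{e}^{tA}r(0)$, denote by $\kappa(t)$ the curvature of its trajectory. (1) If there exists an initial value $r(0)\in\mathbb{R}^2$ such that $\lim_{t\to+\infty}\kappa(t)\neq 0$ or $\lim_{t\to+\infty}\kappa(t)$ does not exist, then the zero solution of the system is stable. (2) If there exists an initial value $r(0)\in\mathbb{R}^2$ such that $\lim_{t\to+\infty}\kappa(t)=+\infty$, then the zero solution of the system is asymptotically stable.
   Context: For a plane curve $r(t)=(x(t),y(t))^{\mathrm T}$ the curvature is $\kappa(t)=\frac{|\dot x\ddot y-\ddot x\dot y|}{(\dot x^2+\dot y^2)^{3/2}}$. Convention: if the trajectory is a constant point (i.e. $\dot r\equiv 0$), then $\kappa(t)\equiv 0$. (For a solution of $\dot r=Ar$, $\dot r$ vanishes either identically or nowhere.) The condition in (1) means that it is not the case that $\kappa(t)\to 0$ as $t\to+\infty$; divergence to $+\infty$ is included. Stability: the zero solution of $\dot r=Ar$ is stable if for every $\varepsilon>0$ there is $\delta>0$ such that $\|r(0)\|<\delta$ implies $\|\mathrm{e}^{tA}r(0)\|<\varepsilon$ for all $t\ge 0$. It is asymptotically stable if it is stable and there is $\delta_1>0$ such that $\|r(0)\|<\delta_1$ implies $\lim_{t\to+\infty}\mathrm{e}^{tA}r(0)=0$. Here $\|\cdot\|$ is the Euclidean norm. *)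

theory Defs
  imports "HOL-Analysis.Analysis"
begin

text \<open>The type of matrices carries no power or \<open>exp\<close> for the matrix product \<open>**\<close>
  (\<open>*\<close> on vectors is componentwise), so both are defined here.\<close>

definition matrix_pow :: "real^'n^'n \<Rightarrow> nat \<Rightarrow> real^'n^'n" where
  "matrix_pow A k = (((**) A) ^^ k) (mat 1)"

definition matrix_exp :: "real^'n^'n \<Rightarrow> real^'n^'n" where
  "matrix_exp A = (\<Sum>k. (1 / fact k) *\<^sub>R matrix_pow A k)"

definition lti_solution :: "real^'n^'n \<Rightarrow> real^'n \<Rightarrow> real \<Rightarrow> real^'n" where
  "lti_solution A r0 t = matrix_exp (t *\<^sub>R A) *v r0"

text \<open>For a constant curve the value is \<open>0 / 0 = 0\<close>, which is the usual convention that
  a trajectory consisting of one point has zero curvature.\<close>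

definition curvature :: "(real \<Rightarrow> real^2) \<Rightarrow> real \<Rightarrow> real" where
  "curvature r t =
    (let x = (\<lambda>s. r s $ 1); y = (\<lambda>s. r s $ 2) in
      \<bar>deriv x t * deriv (deriv y) t - deriv (deriv x) t * deriv y t\<bar>
        / ((deriv x t)\<^sup>2 + (deriv y t)\<^sup>2) powr (3 / 2))"

definition zero_solution_stable :: "real^'n^'n \<Rightarrow> bool" where
  "zero_solution_stable A \<longleftrightarrow>
    (\<forall>\<epsilon>>0. \<exists>\<delta>>0. \<forall>r0. norm r0 < \<delta> \<longrightarrow> (\<forall>t\<ge>0. norm (lti_solution A r0 t) < \<epsilon>))"

definition zero_solution_asymptotically_stable :: "real^'n^'n \<Rightarrow> bool" where
  "zero_solution_asymptotically_stable A \<longleftrightarrow>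
    zero_solution_stable A \<and>
    (\<exists>\<delta>\<^sub>1>0. \<forall>r0. norm r0 < \<delta>\<^sub>1 \<longrightarrow> (lti_solution A r0 \<longlongrightarrow> 0) at_top)"

end

theory Submission
  imports Defs
begin

text \<open>
  The velocity \<open>v = A r\<close> is again a solution, the curvature is
  \<open>\<kappa> = \<bar>w\<bar> / \<bar>v\<bar>\<^sup>3\<close> with \<open>w = det (v, A v)\<close>, and \<open>w' = trace A w\<close>. If \<open>\<kappa>\<close> does not
  tend to \<open>0\<close>, then \<open>w \<noteq> 0\<close>, so \<open>v(0)\<close> and \<open>A v(0)\<close> form a basis. As \<open>e\<^bsup>tA\<^esup>\<close> commutes
  with \<open>A\<close>, every solution is then bounded by a multiple of \<open>\<bar>v\<bar>\<close>, and only this one solution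
  matters; no Jordan form is needed. Since \<open>\<bar>w\<bar> \<le> C \<bar>v\<bar>\<^sup>2\<close>, we have \<open>\<bar>v\<bar> \<kappa> \<le> C\<close>. Hence
  \<open>\<kappa> \<rightarrow> \<infinity>\<close> forces \<open>v \<rightarrow> 0\<close>, and if merely \<open>\<kappa> \<ge> \<epsilon>\<close> at arbitrarily late times, then \<open>v\<close> is
  bounded along these times; this excludes \<open>trace A > 0\<close> and \<open>det A < 0\<close>, while \<open>det A = 0\<close> is
  excluded by \<open>w = det A det (r, A r)\<close>. In the remaining case an energy bounds \<open>v\<close>.
\<close>

section \<open>Matrix powers and the entrywise exponential series\<close>

lemma matrix_pow_0 [simp]: "matrix_pow A 0 = mat 1"
  by (simp add: matrix_pow_def)

lemma matrix_pow_Suc: "matrix_pow A (Suc k) = A ** matrix_pow A k"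
  by (simp add: matrix_pow_def)

lemma matrix_pow_commute: "matrix_pow A k ** A = A ** matrix_pow A k"
  by (induction k) (simp_all add: matrix_pow_Suc matrix_mul_assoc [symmetric])

lemma matrix_pow_scaleR: "matrix_pow (t *\<^sub>R A) k = t ^ k *\<^sub>R matrix_pow A k"
  by (induction k)
    (simp_all add: matrix_pow_Suc matrix_matrix_mult_def vec_eq_iff sum_distrib_left mult_ac)

text \<open>Each row sum of absolute values is at most the sum over the whole matrix, so every
  further factor \<open>A\<close> costs at most one factor \<open>?K\<close>. The row
  \<open>i\<close> varies in the induction because the product mixes rows.\<close>

lemma matrix_pow_entry_le:
  fixes A :: "real^'n^'n"
  shows "\<bar>matrix_pow A k $ i $ j\<bar> \<le> (\<Sum>i\<in>UNIV. \<Sum>j\<in>UNIV. \<bar>A $ i $ j\<bar>) ^ k"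
    (is "_ \<le> ?K ^ k")
proof (induction k arbitrary: i)
  case 0
  show ?case by (simp add: mat_def)
next
  case (Suc k)
  have "\<bar>matrix_pow A (Suc k) $ i $ j\<bar> \<le> (\<Sum>l\<in>UNIV. \<bar>A $ i $ l\<bar> * \<bar>matrix_pow A k $ l $ j\<bar>)"
    by (simp add: matrix_pow_Suc matrix_matrix_mult_def flip: abs_mult)
  also have "\<dots> \<le> (\<Sum>l\<in>UNIV. \<bar>A $ i $ l\<bar> * ?K ^ k)"
    by (intro sum_mono mult_left_mono Suc.IH) simp
  also have "\<dots> = (\<Sum>l\<in>UNIV. \<bar>A $ i $ l\<bar>) * ?K ^ k"
    by (simp add: sum_distrib_right)
  also have "\<dots> \<le> ?K * ?K ^ k"
    by (intro mult_right_mono member_le_sum [of i UNIV "\<lambda>i. \<Sum>l\<in>UNIV. \<bar>A $ i $ l\<bar>"])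
      (auto intro!: sum_nonneg zero_le_power)
  finally show ?case by simp
qed

text \<open>Comparison with the scalar exponential series. Each entry is kept as a power series in
  \<open>t\<close>, so that it can be differentiated term by term.\<close>

lemma summable_matrix_exp_entry:
  fixes A :: "real^'n^'n"
  shows "summable (\<lambda>k. matrix_pow A k $ i $ j / fact k * t ^ k)"
proof (rule summable_comparison_test')
  let ?K = "\<Sum>i\<in>UNIV. \<Sum>j\<in>UNIV. \<bar>A $ i $ j\<bar>"
  show "summable (\<lambda>k. (?K * \<bar>t\<bar>) ^ k /\<^sub>R fact k)"
    by (rule summable_exp_generic)
  show "norm (matrix_pow A k $ i $ j / fact k * t ^ k) \<le> (?K * \<bar>t\<bar>) ^ k /\<^sub>R fact k" for k
    using mult_right_mono [OF matrix_pow_entry_le [of A k i j], of "\<bar>t\<bar> ^ k"]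
    by (simp add: abs_mult power_abs field_simps)
qed

lemma sums_matrix:
  fixes X :: "nat \<Rightarrow> real^'n^'m"
  assumes "\<And>i j. (\<lambda>k. X k $ i $ j) sums Y $ i $ j"
  shows "X sums Y"
  using assms unfolding sums_def by (auto intro!: vec_tendstoI)

lemma matrix_exp_sums:
  fixes A :: "real^'n^'n"
  shows "(\<lambda>k. (1 / fact k) *\<^sub>R matrix_pow A k) sums matrix_exp A"
proof -
  \<comment> \<open>Only convergence matters here: once some limit exists,
    \<open>matrix_exp A\<close> is the sum by definition.\<close>
  have "(\<lambda>k. (1 / fact k) *\<^sub>R matrix_pow A k) sums
      (\<chi> i j. \<Sum>k. matrix_pow A k $ i $ j / fact k)"
    by (rule sums_matrix)
      (use summable_matrix_exp_entry [of A _ _ 1] in \<open>simp add: summable_sums\<close>)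
  then show ?thesis
    unfolding matrix_exp_def by (rule summable_sums [OF sums_summable])
qed

lemma matrix_exp_entry_sums:
  fixes A :: "real^'n^'n"
  shows "(\<lambda>k. matrix_pow A k $ i $ j / fact k * t ^ k) sums matrix_exp (t *\<^sub>R A) $ i $ j"
proof -
  have "bounded_linear (\<lambda>X :: real^'n^'n. X $ i $ j)"
    by (intro bounded_linear_compose [OF bounded_linear_vec_nth bounded_linear_vec_nth])
  from bounded_linear.sums [OF this matrix_exp_sums [of "t *\<^sub>R A"]]
  show ?thesis
    by (simp add: matrix_pow_scaleR mult_ac)
qed

lemma matrix_exp_0: "matrix_exp (0 :: real^'n^'n) = mat 1"
proof -
  have "matrix_exp (0 :: real^'n^'n) $ i $ j = mat 1 $ i $ j" for i j
    using sums_unique2 [OF matrix_exp_entry_sums [of 0 i j 0] powser_sums_zero] by simp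
  then show ?thesis by (simp add: vec_eq_iff)
qed

text \<open>The two series agree term by term, since \<open>A\<close> commutes with its own
  powers.\<close>

lemma matrix_exp_commute:
  fixes A :: "real^'n^'n"
  shows "matrix_exp (t *\<^sub>R A) ** A = A ** matrix_exp (t *\<^sub>R A)"
proof -
  let ?E = "matrix_exp (t *\<^sub>R A)"
  let ?e = "\<lambda>i j k. matrix_pow A k $ i $ j / fact k * t ^ k"
  have "(?E ** A) $ i $ j = (A ** ?E) $ i $ j" for i j
  proof -
    have "(\<lambda>k. \<Sum>l\<in>UNIV. ?e i l k * A $ l $ j) sums (?E ** A) $ i $ j"
      unfolding matrix_matrix_mult_def vec_lambda_beta
      by (intro sums_sum sums_mult2 matrix_exp_entry_sums)
    moreover have "(\<lambda>k. \<Sum>l\<in>UNIV. A $ i $ l * ?e l j k) sums (A ** ?E) $ i $ j"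
      unfolding matrix_matrix_mult_def vec_lambda_beta
      by (intro sums_sum sums_mult matrix_exp_entry_sums)
    moreover have "(\<Sum>l\<in>UNIV. ?e i l k * A $ l $ j) = (\<Sum>l\<in>UNIV. A $ i $ l * ?e l j k)" for k
    proof -
      have "(\<Sum>l\<in>UNIV. ?e i l k * A $ l $ j) = (matrix_pow A k ** A) $ i $ j / fact k * t ^ k"
        by (simp add: matrix_matrix_mult_def sum_divide_distrib sum_distrib_right sum_distrib_left
            mult_ac)
      also have "\<dots> = (\<Sum>l\<in>UNIV. A $ i $ l * ?e l j k)"
        unfolding matrix_pow_commute
        by (simp add: matrix_matrix_mult_def sum_divide_distrib sum_distrib_right sum_distrib_left
            mult_ac)
      finally show ?thesis .
    qed
    ultimately show ?thesis
      using sums_unique2 by fastforce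
  qed
  then show ?thesis by (simp add: vec_eq_iff)
qed

lemma matrix_exp_entry_has_derivative:
  fixes A :: "real^'n^'n"
  shows "((\<lambda>t. matrix_exp (t *\<^sub>R A) $ i $ j) has_real_derivative
    (A ** matrix_exp (t *\<^sub>R A)) $ i $ j) (at t)"
proof -
  let ?c = "\<lambda>i j k. matrix_pow A k $ i $ j / fact k"
  have "((\<lambda>t. \<Sum>k. ?c i j k * t ^ k) has_real_derivative (\<Sum>k. diffs (?c i j) k * t ^ k)) (at t)"
    by (rule termdiffs_strong_converges_everywhere) (rule summable_matrix_exp_entry)
  moreover have "(\<lambda>t. \<Sum>k. ?c i j k * t ^ k) = (\<lambda>t. matrix_exp (t *\<^sub>R A) $ i $ j)"
    by (intro ext sums_unique [symmetric] matrix_exp_entry_sums)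
  moreover have "(\<Sum>k. diffs (?c i j) k * t ^ k) = (A ** matrix_exp (t *\<^sub>R A)) $ i $ j"
  proof -
    \<comment> \<open>The factor \<open>k + 1\<close> from differentiation turns
      \<open>fact (k + 1)\<close> into \<open>fact k\<close>, and the extra power leaves one
      \<open>A\<close> in front.\<close>
    have "diffs (?c i j) k * t ^ k = (\<Sum>l\<in>UNIV. A $ i $ l * (?c l j k * t ^ k))" for k
    proof -
      have "diffs (?c i j) k * t ^ k = (A ** matrix_pow A k) $ i $ j / fact k * t ^ k"
        by (simp add: diffs_def matrix_pow_Suc del: of_nat_Suc)
      also have "\<dots> = (\<Sum>l\<in>UNIV. A $ i $ l * (?c l j k * t ^ k))"
        by (simp add: matrix_matrix_mult_def sum_divide_distrib sum_distrib_right sum_distrib_left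
            mult_ac)
      finally show ?thesis .
    qed
    moreover have "(\<lambda>k. \<Sum>l\<in>UNIV. A $ i $ l * (?c l j k * t ^ k)) sums
        (A ** matrix_exp (t *\<^sub>R A)) $ i $ j"
      unfolding matrix_matrix_mult_def vec_lambda_beta
      by (intro sums_sum sums_mult matrix_exp_entry_sums)
    ultimately show ?thesis
      by (simp only: sums_iff)
  qed
  ultimately show ?thesis by simp
qed

section \<open>Solutions of the linear system\<close>

lemma lti_solution_has_derivative:
  fixes A :: "real^'n^'n"
  shows "((\<lambda>t. lti_solution A x t $ i) has_real_derivative (A *v lti_solution A x t) $ i) (at t)"
proof -
  have "(A *v lti_solution A x t) $ i = (\<Sum>j\<in>UNIV. (A ** matrix_exp (t *\<^sub>R A)) $ i $ j * x $ j)"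
    unfolding lti_solution_def matrix_vector_mul_assoc by (simp add: matrix_vector_mult_def)
  then show ?thesis
    by (auto simp: lti_solution_def matrix_vector_mult_def
        intro!: DERIV_sum DERIV_cmult_right matrix_exp_entry_has_derivative)
qed

lemma lti_solution_0 [simp]: "lti_solution A x 0 = x"
  by (simp add: lti_solution_def matrix_exp_0)

text \<open>Identifies the velocity of a solution as the solution that starts at
  \<open>A *v x\<close>.\<close>

lemma lti_solution_matrix: "lti_solution A (A *v x) t = A *v lti_solution A x t"
  by (simp add: lti_solution_def matrix_vector_mul_assoc matrix_exp_commute)

lemma lti_solution_lincomb:
  "lti_solution A (a *\<^sub>R x + b *\<^sub>R y) t = a *\<^sub>R lti_solution A x t + b *\<^sub>R lti_solution A y t"
  by (simp add: lti_solution_def matrix_vector_right_distrib matrix_vector_mult_scaleR)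

section \<open>Scalar exponential growth\<close>

lemma linear_ode_solution:
  fixes f :: "real \<Rightarrow> real"
  assumes "\<And>t. (f has_real_derivative c * f t) (at t)"
  shows "f t = f 0 * exp (c * t)"
proof -
  \<comment> \<open>Integrating factor.\<close>
  have "((\<lambda>t. f t * exp (- c * t)) has_real_derivative 0) (at t)" for t
    by (auto intro!: derivative_eq_intros assms)
  then have const: "f t * exp (- c * t) = f 0 * exp (- c * 0)"
    using DERIV_isconst_all by blast
  have "f t = f t * exp (- c * t) * exp (c * t)"
    by (simp add: mult.assoc flip: exp_add)
  also have "f t * exp (- c * t) = f 0"
    using const by simp
  finally show ?thesis .
qed

text \<open>For \<open>c > 0\<close> the explicit exponential eventually exceeds any
  \<open>M\<close>, so a bound at arbitrarily late times is already contradictory.\<close>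

lemma exponential_growth_unbounded:
  fixes f :: "real \<Rightarrow> real"
  assumes deriv: "\<And>t. (f has_real_derivative c * f t) (at t)"
    and "f 0 \<noteq> 0" and bounded: "\<exists>\<^sub>F t in at_top. \<bar>f t\<bar> \<le> M"
  shows "c \<le> 0"
proof (rule ccontr)
  assume "\<not> c \<le> 0"
  then have "c > 0" by simp
  have abs_f: "\<bar>f 0\<bar> * exp (c * t) = \<bar>f t\<bar>" for t
    by (simp add: linear_ode_solution [OF deriv, of t] abs_mult)
  have "filterlim (\<lambda>t. \<bar>f 0\<bar> * exp (c * t)) at_top at_top"
    using \<open>c > 0\<close> \<open>f 0 \<noteq> 0\<close>
    by (intro filterlim_tendsto_pos_mult_at_top [OF tendsto_const] filterlim_compose [OF exp_at_top]
        filterlim_ident) auto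
  then have "\<forall>\<^sub>F t in at_top. M < \<bar>f t\<bar>"
    by (simp add: filterlim_at_top_dense abs_f)
  with bounded show False
    by (auto simp: frequently_def not_le)
qed

section \<open>Curvature through the cross product\<close>

definition cross2 :: "real^2 \<Rightarrow> real^2 \<Rightarrow> real" where
  "cross2 u v = u $ 1 * v $ 2 - u $ 2 * v $ 1"

lemma norm_vec2_sq: "(norm (v :: real^2))\<^sup>2 = (v $ 1)\<^sup>2 + (v $ 2)\<^sup>2"
  by (simp add: norm_vec_def L2_set_def sum_2)

lemma abs_cross2_le: "\<bar>cross2 u v\<bar> \<le> norm u * norm v"
proof (rule power2_le_imp_le)
  \<comment> \<open>Lagrange's identity in the plane.\<close>
  have "(norm u * norm v)\<^sup>2 = (cross2 u v)\<^sup>2 + (u $ 1 * v $ 1 + u $ 2 * v $ 2)\<^sup>2"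
    unfolding power_mult_distrib norm_vec2_sq cross2_def by algebra
  then show "\<bar>cross2 u v\<bar>\<^sup>2 \<le> (norm u * norm v)\<^sup>2" by simp
qed auto

lemma curvature_lti_solution:
  fixes A :: "real^2^2" and x :: "real^2"
  defines "v \<equiv> lti_solution A (A *v x)"
  shows "curvature (lti_solution A x) t = \<bar>cross2 (v t) (A *v v t)\<bar> / norm (v t) ^ 3"
proof -
  have v1: "deriv (\<lambda>s. lti_solution A x s $ i) = (\<lambda>s. v s $ i)" for i
    by (simp add: v_def lti_solution_matrix fun_eq_iff DERIV_imp_deriv lti_solution_has_derivative)
  have v2: "deriv (\<lambda>s. v s $ i) t = (A *v v t) $ i" for i
    by (simp add: v_def DERIV_imp_deriv lti_solution_has_derivative)
  have "((norm (v t))\<^sup>2) powr (3 / 2) = norm (v t) ^ 3"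
  \<comment> \<open>At zero velocity both sides are 0, because
    \<open>0 powr (3 / 2) = 0\<close>.\<close>
  proof (cases "v t = 0")
    case False
    then show ?thesis
      by (simp add: powr_powr flip: powr_numeral)
  qed simp
  then show ?thesis
    by (simp add: curvature_def Let_def v1 v2 norm_vec2_sq [symmetric] cross2_def mult_ac)
qed

lemma curvature_lti_solution_le:
  fixes A :: "real^2^2"
  obtains C where "C > 0"
    "\<And>x t. curvature (lti_solution A x) t * norm (lti_solution A (A *v x) t) \<le> C"
proof -
  obtain C where C: "C > 0" "\<And>u. norm (A *v u) \<le> norm u * C"
    using bounded_linear.pos_bounded [OF matrix_vector_mul_bounded_linear [of A]] by blast
  have "curvature (lti_solution A x) t * norm (lti_solution A (A *v x) t) \<le> C" for x t
  proof -
    let ?v = "lti_solution A (A *v x) t"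
    show ?thesis
    proof (cases "?v = 0")
      case False
      have "\<bar>cross2 ?v (A *v ?v)\<bar> \<le> norm ?v * (norm ?v * C)"
        by (rule order_trans [OF abs_cross2_le]) (intro mult_left_mono C norm_ge_zero)
      then show ?thesis
        using False by (simp add: curvature_lti_solution field_simps power3_eq_cube)
    qed (use C in simp)
  qed
  with C show ?thesis using that by blast
qed

text \<open>Cramer's rule expands \<open>x\<close> in the basis \<open>v\<close>,
  \<open>A *v v\<close> with coefficients bounded by multiples of \<open>norm x\<close>. The flow is
  linear and commutes with \<open>A\<close>, so the same coefficients express the solution from
  \<open>x\<close> through the one from \<open>v\<close>.\<close>

lemma lti_solution_le_cyclic:
  fixes A :: "real^2^2"
  assumes "cross2 v (A *v v) \<noteq> 0"
  obtains K where "K > 0"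
    "\<And>x t. norm (lti_solution A x t) \<le> K * norm x * norm (lti_solution A v t)"
proof -
  obtain C where C: "C > 0" "\<And>u. norm (A *v u) \<le> norm u * C"
    using bounded_linear.pos_bounded [OF matrix_vector_mul_bounded_linear [of A]] by blast
  let ?w = "cross2 v (A *v v)"
  define K where "K = (norm (A *v v) + norm v * C) / \<bar>?w\<bar>"
  have "v \<noteq> 0" using assms by (auto simp: cross2_def)
  then have "K > 0"
    using assms C by (auto simp: K_def intro!: divide_pos_pos add_nonneg_pos)
  moreover have "norm (lti_solution A x t) \<le> K * norm x * norm (lti_solution A v t)" for x t
  proof -
    let ?\<phi> = "lti_solution A v t"
    define a where "a = cross2 x (A *v v) / ?w"
    define b where "b = cross2 v x / ?w"
    have "?w *\<^sub>R x = cross2 x (A *v v) *\<^sub>R v + cross2 v x *\<^sub>R (A *v v)"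
      by (simp add: vec_eq_iff forall_2 cross2_def algebra_simps)
    then have "x = a *\<^sub>R v + b *\<^sub>R (A *v v)"
      using assms unfolding a_def b_def
      by (simp add: vec_eq_iff field_simps)
    then have "lti_solution A x t = a *\<^sub>R ?\<phi> + b *\<^sub>R (A *v ?\<phi>)"
      by (metis lti_solution_lincomb lti_solution_matrix)
    then have "norm (lti_solution A x t) \<le> \<bar>a\<bar> * norm ?\<phi> + \<bar>b\<bar> * norm (A *v ?\<phi>)"
      by (metis norm_scaleR norm_triangle_ineq)
    also have "\<dots> \<le> (norm x * norm (A *v v) / \<bar>?w\<bar>) * norm ?\<phi>
        + (norm v * norm x / \<bar>?w\<bar>) * (norm ?\<phi> * C)"
      unfolding a_def b_def
      by (intro add_mono mult_mono C)
        (auto simp: intro!: divide_right_mono abs_cross2_le)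
    also have "\<dots> = K * norm x * norm ?\<phi>"
      by (simp add: K_def add_divide_distrib algebra_simps)
    finally show ?thesis .
  qed
  ultimately show ?thesis using that by blast
qed

section \<open>Trace, determinant and boundedness in the plane\<close>

lemma matrix_vector_mult_2:
  fixes A :: "real^2^2"
  shows "(A *v x) $ i = A $ i $ 1 * x $ 1 + A $ i $ 2 * x $ 2"
  by (simp add: matrix_vector_mult_def sum_2)

text \<open>Multiplicativity of the determinant, \<open>cross2 u v\<close> being that of the matrix
  with columns \<open>u\<close> and \<open>v\<close>.\<close>

lemma cross2_matrix: "cross2 (A *v u) (A *v v) = det A * cross2 u v"
  by (simp add: cross2_def matrix_vector_mult_2 det_2 algebra_simps)

text \<open>Cayley-Hamilton makes every solution satisfy \<open>v'' = trace A v' - det A v\<close>.\<close>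

lemma cayley_hamilton_2:
  fixes A :: "real^2^2"
  shows "A *v (A *v x) = trace A *\<^sub>R (A *v x) - det A *\<^sub>R x"
  by (simp add: vec_eq_iff forall_2 matrix_vector_mult_2 det_2 trace_def sum_2 algebra_simps)

text \<open>Liouville's formula for the area spanned by two solutions, here \<open>v\<close> and its
  derivative.\<close>

lemma cross2_lti_solution_has_derivative:
  fixes A :: "real^2^2" and x :: "real^2"
  defines "v \<equiv> lti_solution A x"
  shows "((\<lambda>t. cross2 (v t) (A *v v t)) has_real_derivative
    trace A * cross2 (v t) (A *v v t)) (at t)"
  unfolding cross2_def matrix_vector_mult_2 v_def
  by (auto intro!: derivative_eq_intros lti_solution_has_derivative
      simp: matrix_vector_mult_2 trace_def sum_2 algebra_simps)

text \<open>A saddle is impossible: with eigenvalues \<open>\<mu> < 0 < \<rho>\<close> the vector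
  \<open>A v - \<mu> v\<close> grows like \<open>e\<^sup>\<rho>\<^sup>t\<close>.\<close>

lemma det_nonneg_if_frequently_bounded:
  fixes A :: "real^2^2"
  assumes cyclic: "cross2 v (A *v v) \<noteq> 0"
    and bounded: "\<exists>\<^sub>F t in at_top. norm (lti_solution A v t) \<le> M"
  shows "det A \<ge> 0"
proof (rule ccontr)
  assume "\<not> det A \<ge> 0"
  define T D s where "T = trace A" and "D = det A" and "s = sqrt (T\<^sup>2 - 4 * D)"
  define \<rho> \<mu> where "\<rho> = (T + s) / 2" and "\<mu> = (T - s) / 2"
  have "D < 0" using \<open>\<not> det A \<ge> 0\<close> by (simp add: D_def)
  then have s2: "s\<^sup>2 = T\<^sup>2 - 4 * D"
    unfolding s_def by (intro real_sqrt_pow2) (smt (verit) zero_le_power2)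
  \<comment> \<open>A negative determinant makes the discriminant exceed the squared trace, so the
    roots have opposite signs.\<close>
  have "\<bar>T\<bar> < s"
    unfolding s_def by (rule real_less_rsqrt) (use \<open>D < 0\<close> in simp)
  then have "\<rho> > 0" by (simp add: \<rho>_def)
  have roots: "T - \<mu> = \<rho>" "D = \<rho> * \<mu>"
    using s2 by (simp_all add: \<rho>_def \<mu>_def field_simps power2_eq_square)
  let ?\<phi> = "lti_solution A v"
  \<comment> \<open>Otherwise \<open>v\<close> would be an eigenvector and its cross product with
    \<open>A *v v\<close> would vanish.\<close>
  have "A *v v - \<mu> *\<^sub>R v \<noteq> 0"
    using cyclic by (auto simp: cross2_def)
  then obtain i where i: "(A *v v - \<mu> *\<^sub>R v) $ i \<noteq> 0"
    by (auto simp: vec_eq_iff)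
  define z where "z t = (A *v ?\<phi> t - \<mu> *\<^sub>R ?\<phi> t) $ i" for t
  have z_deriv: "(z has_real_derivative \<rho> * z t) (at t)" for t
  proof -
    have "(z has_real_derivative (A *v (A *v ?\<phi> t)) $ i - \<mu> * (A *v ?\<phi> t) $ i) (at t)"
      using lti_solution_has_derivative [of A "A *v v" i t] lti_solution_has_derivative [of A v i t]
      unfolding z_def lti_solution_matrix by (auto intro!: derivative_eq_intros)
    moreover have "(A *v (A *v ?\<phi> t)) $ i - \<mu> * (A *v ?\<phi> t) $ i = \<rho> * z t"
      using roots by (simp add: cayley_hamilton_2 z_def T_def [symmetric] D_def [symmetric] algebra_simps)
    ultimately show ?thesis by simp
  qed
  obtain C where C: "C > 0" "\<And>u. norm (A *v u) \<le> norm u * C"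
    using bounded_linear.pos_bounded [OF matrix_vector_mul_bounded_linear [of A]] by blast
  have "\<bar>z t\<bar> \<le> M * (C + \<bar>\<mu>\<bar>)" if "norm (?\<phi> t) \<le> M" for t
  proof -
    have "\<bar>z t\<bar> \<le> norm (A *v ?\<phi> t - \<mu> *\<^sub>R ?\<phi> t)"
      unfolding z_def by (rule component_le_norm_cart)
    also have "\<dots> \<le> norm (A *v ?\<phi> t) + norm (\<mu> *\<^sub>R ?\<phi> t)"
      by (rule norm_triangle_ineq4)
    also have "\<dots> \<le> norm (?\<phi> t) * (C + \<bar>\<mu>\<bar>)"
      using C(2) [of "?\<phi> t"] by (simp add: algebra_simps)
    also have "\<dots> \<le> M * (C + \<bar>\<mu>\<bar>)"
      using that C(1) by (intro mult_right_mono) auto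
    finally show ?thesis .
  qed
  then have "\<exists>\<^sub>F t in at_top. \<bar>z t\<bar> \<le> M * (C + \<bar>\<mu>\<bar>)"
    by (rule frequently_elim1 [OF bounded])
  moreover have "z 0 \<noteq> 0" using i by (simp add: z_def)
  ultimately have "\<rho> \<le> 0"
    using exponential_growth_unbounded z_deriv by blast
  with \<open>\<rho> > 0\<close> show False by simp
qed

text \<open>For \<open>trace A \<le> 0 < det A\<close> the energy \<open>det A \<bar>v\<bar>\<^sup>2 + \<bar>v'\<bar>\<^sup>2\<close> has derivative
  \<open>2 trace A \<bar>v'\<bar>\<^sup>2\<close>.\<close>

lemma lti_solution_bounded:
  fixes A :: "real^2^2"
  assumes "trace A \<le> 0" and "det A > 0"
  obtains B where "B > 0" "\<And>t. t \<ge> 0 \<Longrightarrow> norm (lti_solution A x t) \<le> B"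
proof -
  let ?\<phi> = "lti_solution A x"
  define E where "E t = det A * (norm (?\<phi> t))\<^sup>2 + (norm (A *v ?\<phi> t))\<^sup>2" for t
  have E_deriv: "(E has_real_derivative 2 * trace A * (norm (A *v ?\<phi> t))\<^sup>2) (at t)" for t
    unfolding E_def norm_vec2_sq matrix_vector_mult_2
    by (auto intro!: derivative_eq_intros lti_solution_has_derivative
        simp: matrix_vector_mult_2 trace_def sum_2 det_2 power2_eq_square algebra_simps)
  \<comment> \<open>The initial energy bounds \<open>det A\<close> times the squared norm at later
    times; the added 1 keeps \<open>B\<close> positive even when \<open>E 0 = 0\<close>.\<close>
  define B where "B = sqrt (E 0 / det A) + 1"
  have "E 0 \<ge> 0" unfolding E_def using assms by simp
  then have "B > 0" using assms by (auto simp: B_def intro!: add_nonneg_pos)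
  moreover have "norm (?\<phi> t) \<le> B" if "t \<ge> 0" for t
  proof -
    have "E t \<le> E 0"
      using that
    proof (rule DERIV_nonpos_imp_nonincreasing)
      show "\<exists>y. (E has_real_derivative y) (at s) \<and> y \<le> 0" for s
        using E_deriv assms(1) by (blast intro: mult_nonpos_nonneg mult_nonneg_nonpos zero_le_power2
            zero_le_numeral)
    qed
    then have "det A * (norm (?\<phi> t))\<^sup>2 \<le> E 0"
      unfolding E_def [of t] by (smt (verit) zero_le_power2)
    then have "norm (?\<phi> t) \<le> sqrt (E 0 / det A)"
      using assms by (intro real_le_rsqrt) (simp add: field_simps)
    then show ?thesis by (simp add: B_def)
  qed
  ultimately show ?thesis using that by blast
qed

section \<open>From curvature to stability\<close>

lemma curvature_eq_0:
  assumes "cross2 (A *v x) (A *v (A *v x)) = 0"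
  shows "curvature (lti_solution A x) t = 0"
  \<comment> \<open>By the scalar linear equation, a cross product that is zero at time 0 is zero at
    all times.\<close>
  using linear_ode_solution [OF cross2_lti_solution_has_derivative [of A "A *v x"], of t] assms
  by (simp add: curvature_lti_solution)

lemma stable_if_curvature_not_tendsto_0:
  fixes A :: "real^2^2"
  assumes "\<not> (curvature (lti_solution A x) \<longlongrightarrow> 0) at_top"
  shows "cross2 (A *v x) (A *v (A *v x)) \<noteq> 0" and "zero_solution_stable A"
proof -
  let ?v = "A *v x" and ?\<kappa> = "curvature (lti_solution A x)"
  let ?\<phi> = "lti_solution A ?v"
  show cyclic: "cross2 ?v (A *v ?v) \<noteq> 0"
    using assms curvature_eq_0 [of A x] by (metis (no_types, lifting) ext tendsto_const)
  obtain C where C: "C > 0" "\<And>t. ?\<kappa> t * norm (?\<phi> t) \<le> C"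
    using curvature_lti_solution_le [of A] by metis
  \<comment> \<open>Curvature is nonnegative, so failure to tend to 0 means exceeding some
    \<epsilon> at arbitrarily late times.\<close>
  obtain \<epsilon> where "\<epsilon> > 0" and freq: "\<exists>\<^sub>F t in at_top. \<epsilon> \<le> ?\<kappa> t"
    using assms
    by (auto simp: tendsto_iff not_eventually not_less curvature_lti_solution)
  have bound: "\<exists>\<^sub>F t in at_top. norm (?\<phi> t) \<le> C / \<epsilon>"
  proof (rule frequently_elim1 [OF freq])
    fix t assume "\<epsilon> \<le> ?\<kappa> t"
    then have "\<epsilon> * norm (?\<phi> t) \<le> C"
      using C(2) [of t] mult_right_mono [of \<epsilon> "?\<kappa> t" "norm (?\<phi> t)"] by simp
    then show "norm (?\<phi> t) \<le> C / \<epsilon>"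
      using \<open>\<epsilon> > 0\<close> by (simp add: field_simps)
  qed
  have "trace A \<le> 0"
  proof -
    obtain C' where C': "C' > 0" "\<And>u. norm (A *v u) \<le> norm u * C'"
      using bounded_linear.pos_bounded [OF matrix_vector_mul_bounded_linear [of A]] by blast
    have "\<bar>cross2 (?\<phi> t) (A *v ?\<phi> t)\<bar> \<le> (C / \<epsilon>) * (C / \<epsilon> * C')"
      if "norm (?\<phi> t) \<le> C / \<epsilon>" for t
    proof -
      have "\<bar>cross2 (?\<phi> t) (A *v ?\<phi> t)\<bar> \<le> norm (?\<phi> t) * norm (A *v ?\<phi> t)"
        by (rule abs_cross2_le)
      also have "\<dots> \<le> (C / \<epsilon>) * (C / \<epsilon> * C')"
        using that C C' \<open>\<epsilon> > 0\<close>
        by (intro mult_mono order_trans [OF C'(2)] mult_right_mono) auto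
      finally show ?thesis .
    qed
    then have "\<exists>\<^sub>F t in at_top. \<bar>cross2 (?\<phi> t) (A *v ?\<phi> t)\<bar> \<le> (C / \<epsilon>) * (C / \<epsilon> * C')"
      by (rule frequently_elim1 [OF bound])
    with exponential_growth_unbounded [OF cross2_lti_solution_has_derivative [of A ?v]] cyclic
    show ?thesis by simp
  qed
  \<comment> \<open>As \<open>?v\<close> lies in the image of \<open>A\<close>, its cross product
    with \<open>A *v ?v\<close> carries the factor \<open>det A\<close>, which therefore cannot be
    0.\<close>
  moreover have "det A > 0"
    using det_nonneg_if_frequently_bounded [OF cyclic bound] cyclic
    by (auto simp: cross2_matrix less_le)
  ultimately obtain B where B: "B > 0" "\<And>t. t \<ge> 0 \<Longrightarrow> norm (?\<phi> t) \<le> B"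
    using lti_solution_bounded by metis
  obtain K where K: "K > 0" "\<And>y t. norm (lti_solution A y t) \<le> K * norm y * norm (?\<phi> t)"
    using lti_solution_le_cyclic [OF cyclic] by metis
  show "zero_solution_stable A"
    unfolding zero_solution_stable_def
  proof (intro allI impI)
    fix e :: real assume "e > 0"
    have "norm (lti_solution A y t) < e" if "norm y < e / (K * B)" "t \<ge> 0" for y t
    proof -
      have "norm (lti_solution A y t) \<le> K * norm y * B"
        by (intro order_trans [OF K(2)] mult_left_mono B(2) \<open>t \<ge> 0\<close>) (use K(1) in simp)
      also have "\<dots> < e"
        using that K B by (simp add: field_simps)
      finally show ?thesis .
    qed
    then show "\<exists>\<delta>>0. \<forall>y. norm y < \<delta> \<longrightarrow> (\<forall>t\<ge>0. norm (lti_solution A y t) < e)"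
      using K B \<open>e > 0\<close> by (intro exI [of _ "e / (K * B)"]) auto
  qed
qed

lemma asymptotically_stable_if_curvature_at_top:
  fixes A :: "real^2^2"
  assumes lim: "filterlim (curvature (lti_solution A x)) at_top at_top"
  shows "zero_solution_asymptotically_stable A"
proof -
  let ?v = "A *v x" and ?\<kappa> = "curvature (lti_solution A x)"
  let ?\<phi> = "lti_solution A ?v"
  have "\<not> (?\<kappa> \<longlongrightarrow> 0) at_top"
    using lim not_tendsto_and_filterlim_at_infinity filterlim_at_top_imp_at_infinity
      trivial_limit_at_top_linorder by blast
  note stable = stable_if_curvature_not_tendsto_0 [OF this]
  obtain C where C: "C > 0" "\<And>t. ?\<kappa> t * norm (?\<phi> t) \<le> C"
    using curvature_lti_solution_le [of A] by metis
  obtain K where K: "K > 0" "\<And>y t. norm (lti_solution A y t) \<le> K * norm y * norm (?\<phi> t)"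
    using lti_solution_le_cyclic [OF stable(1)] by metis
  have "(?\<phi> \<longlongrightarrow> 0) at_top"
  proof (rule Lim_null_comparison)
    show "\<forall>\<^sub>F t in at_top. norm (?\<phi> t) \<le> C / ?\<kappa> t"
      \<comment> \<open>The curvature is eventually positive, which permits division by it.\<close>
      using filterlim_at_top_dense [THEN iffD1, OF lim, rule_format, of 0]
      by eventually_elim (use C in \<open>simp add: field_simps\<close>)
    show "((\<lambda>t. C / ?\<kappa> t) \<longlongrightarrow> 0) at_top"
      by (rule tendsto_divide_0 [OF tendsto_const filterlim_at_top_imp_at_infinity [OF lim]])
  qed
  then have "(lti_solution A y \<longlongrightarrow> 0) at_top" for y
    by (rule tendsto_0_le [where K = "K * norm y"])
      (use K(2) [of y] in \<open>simp add: mult.commute\<close>)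
  with stable show ?thesis
    unfolding zero_solution_asymptotically_stable_def using zero_less_one by blast
qed

theorem theorem1p1:
  fixes A :: "real^2^2"
  shows "((\<exists>r0. \<not> (curvature (lti_solution A r0) \<longlongrightarrow> 0) at_top)
            \<longrightarrow> zero_solution_stable A) \<and>
         ((\<exists>r0. filterlim (curvature (lti_solution A r0)) at_top at_top)
            \<longrightarrow> zero_solution_asymptotically_stable A)"
  using stable_if_curvature_not_tendsto_0(2) asymptotically_stable_if_curvature_at_top by blast

end
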